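(* Let $\mathbf{x}=\mathbf{A}\boldsymbol{\theta}_0+\mathbf{v}$ be the linear model of the context, where $\mathbf{A}=(a_{ij})\in\mathbb{R}^{N\times p}$ is a known (non-random) matrix, and assume A6 and A8 of the context. Put $\sigma_{min}=\lambda_{min}\left(\frac1N\mathbf{A}^T\mathbf{A}\right)$ and $\alpha=\max_{i,j}|a_{ij}|$, and let $\hat{\boldsymbol{\theta}}^N_0=(\mathbf{A}^T\mathbf{A})^{-1}\mathbf{A}^T\mathbf{x}$ be the least squares estimator. Let $\varepsilon>0$ and $r>0$ be given. Then for all $N>N(r,\varepsilon)$, $$P\left(\|\hat{\boldsymbol{\theta}}^N_0-\boldsymbol{\theta}_0\|_\infty>r\right)<\varepsilon,\qquad\text{where}\qquad N(r,\varepsilon)=\frac{8\alpha^2R^2}{r^2\sigma_{min}^2}\log\frac{2p}{\varepsilon}.$$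
   Context: Model: $\mathbf{x}=\mathbf{A}\boldsymbol{\theta}_0+\mathbf{v}$, where $\mathbf{x}\in\mathbb{R}^{N\times 1}$ is the output, $\mathbf{A}\in\mathbb{R}^{N\times p}$ is the design matrix, $\boldsymbol{\theta}_0\in\mathbb{R}^p$ is the true parameter, $\mathbf{v}=(v_1,\dots,v_N)^T$ is the noise, and $N$ is the number of samples. Standing assumptions: the noise is zero mean, $N>p$, and the least squares solution exists ($\mathbf{A}^T\mathbf{A}$ is invertible, so $\sigma_{min}>0$). $\lambda_{min}(\mathbf B)$ denotes the smallest eigenvalue of $\mathbf B$. Assumptions: A6: $(v_n)$ is a martingale difference sequence with respect to a filtration $(F_n)$ (so $v_n$ is $F_n$-measurable), i.e. $E(v_n\mid F_{n-1})=0$. A8: the martingale difference sequence is $R$ sub-Gaussian, i.e. $E(e^{sv_n}\mid F_{n-1})\le e^{s^2R^2/2}$ for all $n$ and all $s$. *)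

theory Defs
  imports
    "HOL-Probability.Probability"
    "Jordan_Normal_Form.Gauss_Jordan_Elimination"
    "Jordan_Normal_Form.Spectral_Radius"
begin

no_notation Finite_Cartesian_Product.vec_nth (infixl \<open>$\<close> 90)

text \<open>
  The filtration is indexed by \<open>n \<ge> 0\<close> and the noise by \<open>n \<ge> 1\<close>, so that the \<open>\<sigma>\<close>-algebra
  \<open>F (n - 1)\<close> is available for the first noise term; \<open>v 0\<close> is irrelevant.
\<close>

definition martingale_difference_sequence ::
    "'a measure \<Rightarrow> (nat \<Rightarrow> 'a measure) \<Rightarrow> (nat \<Rightarrow> 'a \<Rightarrow> real) \<Rightarrow> bool" where
  "martingale_difference_sequence M F v \<longleftrightarrow>
     filtration (space M) F \<and> (\<forall>n. subalgebra M (F n)) \<and>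
     (\<forall>n\<ge>1. v n \<in> borel_measurable (F n) \<and> integrable M (v n) \<and>
        (AE \<omega> in M. real_cond_exp M (F (n - 1)) (v n) \<omega> = 0))"

text \<open>
  The conditional expectation of the nonnegative variable \<open>exp (s * v n)\<close> is taken in
  \<^typ>\<open>ennreal\<close>: \<^const>\<open>real_cond_exp\<close> is a junk value when the conditional expectation is
  infinite, and would make the bound hold vacuously there.
\<close>

definition conditionally_sub_Gaussian ::
    "'a measure \<Rightarrow> (nat \<Rightarrow> 'a measure) \<Rightarrow> real \<Rightarrow> (nat \<Rightarrow> 'a \<Rightarrow> real) \<Rightarrow> bool" where
  "conditionally_sub_Gaussian M F R v \<longleftrightarrow>
     (\<forall>n\<ge>1. \<forall>s::real. AE \<omega> in M.
        nn_cond_exp M (F (n - 1)) (\<lambda>\<omega>. ennreal (exp (s * v n \<omega>))) \<omega>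
          \<le> ennreal (exp (s\<^sup>2 * R\<^sup>2 / 2)))"

text \<open>Vector positions are counted from 0, noise terms from 1.\<close>

definition noise_vec :: "nat \<Rightarrow> (nat \<Rightarrow> 'a \<Rightarrow> real) \<Rightarrow> 'a \<Rightarrow> real vec" where
  "noise_vec N v \<omega> = Matrix.vec N (\<lambda>i. v (Suc i) \<omega>)"

text \<open>
  \<^const>\<open>spectrum\<close> of a real matrix collects its real eigenvalues only. For the symmetric
  matrices of positive dimension used here these are all eigenvalues, and the set is finite
  and nonempty.
\<close>

definition lambda_min :: "real mat \<Rightarrow> real" where
  "lambda_min B = Min (spectrum B)"

definition sigma_min :: "real mat \<Rightarrow> real" where
  "sigma_min A = lambda_min ((1 / real (dim_row A)) \<cdot>\<^sub>m (transpose_mat A * A))"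

definition max_abs_entry :: "real mat \<Rightarrow> real" where
  "max_abs_entry A = Max (abs ` elements_mat A)"

definition linf_norm :: "real vec \<Rightarrow> real" where
  "linf_norm w = Max {\<bar>w $ i\<bar> | i. i < dim_vec w}"

text \<open>Meaningful only when \<open>A\<^sup>T A\<close> is invertible; otherwise \<^const>\<open>mat_inverse\<close> is \<open>None\<close>.\<close>

definition least_squares :: "real mat \<Rightarrow> real vec \<Rightarrow> real vec" where
  "least_squares A x =
     the (mat_inverse (transpose_mat A * A)) *\<^sub>v (transpose_mat A *\<^sub>v x)"

definition sample_threshold :: "real mat \<Rightarrow> real \<Rightarrow> real \<Rightarrow> real \<Rightarrow> real" where
  "sample_threshold A R r \<epsilon> =
     8 * (max_abs_entry A)\<^sup>2 * R\<^sup>2 / (r\<^sup>2 * (sigma_min A)\<^sup>2) * ln (2 * real (dim_col A) / \<epsilon>)"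

end

theory Submission
  imports Defs
begin

text \<open>
  Write \<open>S = A\<^sup>T A\<close>. Each component of the estimation error is a fixed linear combination of the
  noise, \<open>(A y) \<bullet> v\<close> with \<open>S y = e\<^sub>i\<close> (lemma \<open>least_squares_error_component\<close>). Conditioning on one
  noise term after another shows that such a combination \<open>c \<bullet> v\<close> has a moment generating function
  at most \<open>exp (s\<^sup>2 R\<^sup>2 |c|\<^sup>2 / 2)\<close>, as if the terms were independent
  (\<open>sub_Gaussian_martingale_mgf\<close>), so Chernoff's bound controls both of its tails.

  What remains is the size of \<open>|A y|\<^sup>2\<close>. It equals the diagonal entry \<open>y\<^sub>i\<close> of the inverse of \<open>S\<close>,
  and the smallest eigenvalue \<open>N \<sigma>\<close> of \<open>S\<close> bounds it by \<open>1 / (N \<sigma>)\<close>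
  (\<open>gram_inverse_column_bound\<close>). This rests on the variational description of the smallest
  eigenvalue: the Rayleigh quotient attains its minimum on the compact unit sphere, and a minimizer
  is an eigenvector (\<open>lambda_min_symmetric\<close>).

  A union bound over the \<open>p\<close> components with Chernoff parameter \<open>s = 2 L / r\<close>, where
  \<open>L = ln (2 p / \<epsilon>)\<close>, then gives a probability below \<open>\<epsilon>\<close> as soon as
  \<open>N > 2 R\<^sup>2 L / (r\<^sup>2 \<sigma>)\<close>. The stated threshold is larger because \<open>\<sigma> \<le> \<alpha>\<^sup>2\<close>
  (\<open>sigma_min_le_max_abs_entry\<close>), that is \<open>1 / \<sigma> \<le> \<alpha>\<^sup>2 / \<sigma>\<^sup>2\<close>. For \<open>\<epsilon> > 1\<close> there is nothing to
  prove.
\<close>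

no_notation Inner_Product.real_inner_class.inner (infix "\<bullet>" 70)

section \<open>The smallest eigenvalue of a symmetric matrix\<close>

lemma scalar_prod_self_nonneg: "0 \<le> x \<bullet> (x :: real vec)"
  unfolding scalar_prod_def by (simp add: sum_nonneg)

lemma scalar_prod_self_eq_0:
  fixes x :: "real vec"
  assumes "x \<bullet> x = 0" and "x \<in> carrier_vec n"
  shows "x = 0\<^sub>v n"
proof -
  have "\<forall>i\<in>{0..<dim_vec x}. x $ i * x $ i = 0"
    using assms(1) unfolding scalar_prod_def by (subst (asm) sum_nonneg_eq_0_iff) auto
  then show ?thesis using assms(2) by (intro eq_vecI) auto
qed

lemma square_entry_le_scalar_prod_self:
  fixes x :: "real vec"
  assumes "i < dim_vec x"
  shows "(x $ i)\<^sup>2 \<le> x \<bullet> x"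
  unfolding scalar_prod_def power2_eq_square
  using assms by (intro member_le_sum[where f = "\<lambda>i. x $ i * x $ i"]) auto

text \<open>
  Compactness of the unit sphere. The dimension \<open>p\<close> is a variable, so the sphere is placed in the
  space of all real sequences with the product topology, as a closed subset of the cube
  \<open>[-1, 1]\<^sup>\<nat>\<close>, which is compact by Tychonoff's theorem.
\<close>

lemma quadratic_form_attains_min_on_sphere:
  fixes G :: "real mat"
  assumes G: "G \<in> carrier_mat p p" and p: "0 < p"
  obtains u where "u \<in> carrier_vec p" and "u \<bullet> u = 1"
    and "\<And>x. x \<in> carrier_vec p \<Longrightarrow> (u \<bullet> (G *\<^sub>v u)) * (x \<bullet> x) \<le> x \<bullet> (G *\<^sub>v x)"
proof -
  define q :: "(nat \<Rightarrow> real) \<Rightarrow> real" where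
    "q f = (\<Sum>i<p. f i * (\<Sum>j<p. G $$ (i,j) * f j))" for f
  define K :: "(nat \<Rightarrow> real) set" where
    "K = (UNIV \<rightarrow>\<^sub>E {-1..1}) \<inter> {f. (\<Sum>i<p. f i * f i) = 1}"
  have q: "Matrix.vec p f \<bullet> (G *\<^sub>v Matrix.vec p f) = q f" for f
    using G unfolding q_def scalar_prod_def by (auto simp: atLeast0LessThan scalar_prod_def)
  have sq: "Matrix.vec p f \<bullet> Matrix.vec p f = (\<Sum>i<p. f i * f i)" for f :: "nat \<Rightarrow> real"
    unfolding scalar_prod_def by (auto simp: atLeast0LessThan)
  have coord: "continuous_on S (\<lambda>f. f i)" for S :: "(nat \<Rightarrow> real) set" and i
    by (rule continuous_on_subset[OF continuous_on_product_coordinates]) simp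
  have "compactin (product_topology (\<lambda>_. euclidean) UNIV)
          ((UNIV :: nat set) \<rightarrow>\<^sub>E {-1..1::real})"
    by (subst compactin_PiE) auto
  then have box: "compact ((UNIV :: nat set) \<rightarrow>\<^sub>E {-1..1::real})"
    by (simp add: euclidean_product_topology)
  have "closed {f :: nat \<Rightarrow> real. (\<Sum>i<p. f i * f i) = 1}"
    by (intro closed_Collect_eq continuous_intros coord)
  with box have K: "compact K"
    unfolding K_def by (rule compact_Int_closed)
  have "(\<lambda>i. if i = 0 then 1 else 0) \<in> K"
    using p unfolding K_def by (auto simp: if_distrib cong: if_cong)
  then have "K \<noteq> {}" by blast
  moreover have "continuous_on K q"
    unfolding q_def by (intro continuous_intros coord)
  ultimately obtain f where f: "f \<in> K" and min: "\<And>g. g \<in> K \<Longrightarrow> q f \<le> q g"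
    using continuous_attains_inf[OF K] by blast
  show thesis
  proof
    let ?u = "Matrix.vec p f"
    show "?u \<in> carrier_vec p" by simp
    show "?u \<bullet> ?u = 1" using f by (simp add: sq K_def)
    fix x :: "real vec"
    assume x: "x \<in> carrier_vec p"
    show "(?u \<bullet> (G *\<^sub>v ?u)) * (x \<bullet> x) \<le> x \<bullet> (G *\<^sub>v x)"
    proof (cases "x \<bullet> x = 0")
      case True
      then have "x = 0\<^sub>v p" using x by (rule scalar_prod_self_eq_0)
      then show ?thesis using G by simp
    next
      case False
      define c where "c = sqrt (x \<bullet> x)"
      have c: "c > 0" "c * c = x \<bullet> x"
        using False scalar_prod_self_nonneg[of x] by (auto simp: c_def)
      \<comment> \<open>Coordinates beyond the dimension are set to 0, which keeps the point in the cube.\<close>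
      define g where "g = (\<lambda>i. if i < p then x $ i / c else 0)"
      have xg: "x = c \<cdot>\<^sub>v Matrix.vec p g"
        using x c by (intro eq_vecI) (auto simp: g_def)
      have xx: "x \<bullet> x = c * c * (Matrix.vec p g \<bullet> Matrix.vec p g)"
        by (subst (1 2) xg) (simp add: ac_simps)
      have g1: "(\<Sum>i<p. g i * g i) = 1"
        using xx c unfolding sq by auto
      have "\<bar>g i\<bar> \<le> 1" for i
      proof (cases "i < p")
        case True
        then have "g i * g i \<le> (\<Sum>i<p. g i * g i)"
          by (intro member_le_sum) auto
        then show ?thesis using g1 by (simp add: abs_square_le_1[symmetric] power2_eq_square)
      qed (simp add: g_def)
      then have "g i \<in> {-1..1}" for i by (simp add: abs_le_iff minus_le_iff[of "g i"])
      then have "g \<in> K" using g1 by (auto simp: K_def)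
      then have "q f * (x \<bullet> x) \<le> q g * (x \<bullet> x)"
        using min scalar_prod_self_nonneg by (intro mult_right_mono) auto
      also have "\<dots> = x \<bullet> (G *\<^sub>v x)"
      proof -
        have "G *\<^sub>v x = c \<cdot>\<^sub>v (G *\<^sub>v Matrix.vec p g)"
          using G by (subst xg) (auto intro!: mult_mat_vec)
        then show ?thesis
          using G c(2) by (subst xg, simp add: q[symmetric])
      qed
      finally show ?thesis by (simp add: q)
    qed
  qed
qed

text \<open>
  With \<open>\<mu> = u \<bullet> G u\<close>, the form \<open>x \<bullet> G x - \<mu> (x \<bullet> x)\<close> is nonnegative and vanishes at \<open>u\<close>, so its first
  variation at \<open>u\<close> vanishes in every direction. In the direction of the residual
  \<open>w = G u - \<mu> u\<close> that variation is \<open>2 (w \<bullet> w)\<close>, by the symmetry of \<open>G\<close>.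
\<close>

lemma rayleigh_minimizer_is_eigenvector:
  fixes G :: "real mat"
  assumes G: "G \<in> carrier_mat p p" and sym: "transpose_mat G = G"
    and u: "u \<in> carrier_vec p" and u1: "u \<bullet> u = 1"
    and min: "\<And>x. x \<in> carrier_vec p \<Longrightarrow> (u \<bullet> (G *\<^sub>v u)) * (x \<bullet> x) \<le> x \<bullet> (G *\<^sub>v x)"
  shows "G *\<^sub>v u = (u \<bullet> (G *\<^sub>v u)) \<cdot>\<^sub>v u"
proof -
  define \<mu> where "\<mu> = u \<bullet> (G *\<^sub>v u)"
  define w where "w = G *\<^sub>v u - \<mu> \<cdot>\<^sub>v u"
  have Gu: "G *\<^sub>v u \<in> carrier_vec p" using G u by simp
  have w: "w \<in> carrier_vec p" using Gu u unfolding w_def by simp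
  have Gw: "G *\<^sub>v w \<in> carrier_vec p" using G w by simp
  define c where "c = w \<bullet> (G *\<^sub>v w) - \<mu> * (w \<bullet> w)"
  have ww: "w \<bullet> w = w \<bullet> (G *\<^sub>v u) - \<mu> * (w \<bullet> u)"
  proof -
    have "w \<bullet> w = w \<bullet> (G *\<^sub>v u - \<mu> \<cdot>\<^sub>v u)" by (simp only: w_def)
    also have "\<dots> = w \<bullet> (G *\<^sub>v u) - \<mu> * (w \<bullet> u)"
      using scalar_prod_minus_distrib[OF w Gu, of "\<mu> \<cdot>\<^sub>v u"] u w by simp
    finally show ?thesis .
  qed
  have sym': "u \<bullet> (G *\<^sub>v w) = w \<bullet> (G *\<^sub>v u)"
    using transpose_vec_mult_scalar[OF G w u] comm_scalar_prod[OF Gu w] by (simp add: sym)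
  have var: "0 \<le> 2 * t * (w \<bullet> w) + t\<^sup>2 * c" for t
  proof -
    let ?x = "u + t \<cdot>\<^sub>v w"
    have tw: "t \<cdot>\<^sub>v w \<in> carrier_vec p" and x: "?x \<in> carrier_vec p" using u w by auto
    have "?x \<bullet> ?x = 1 + 2 * t * (w \<bullet> u) + t\<^sup>2 * (w \<bullet> w)"
      using u w comm_scalar_prod[OF u w] u1
        add_scalar_prod_distrib[OF u tw x] scalar_prod_add_distrib[OF u u tw]
        scalar_prod_add_distrib[OF tw u tw]
      by (simp add: power2_eq_square algebra_simps)
    moreover have "?x \<bullet> (G *\<^sub>v ?x) = \<mu> + 2 * t * (w \<bullet> (G *\<^sub>v u)) + t\<^sup>2 * (w \<bullet> (G *\<^sub>v w))"
    proof -
      have tGw: "t \<cdot>\<^sub>v (G *\<^sub>v w) \<in> carrier_vec p" using Gw by simp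
      have Gx: "G *\<^sub>v ?x = G *\<^sub>v u + t \<cdot>\<^sub>v (G *\<^sub>v w)"
        using mult_add_distrib_mat_vec[OF G u tw] mult_mat_vec[OF G w] by simp
      show ?thesis unfolding Gx
        using add_scalar_prod_distrib[OF u tw, of "G *\<^sub>v u + t \<cdot>\<^sub>v (G *\<^sub>v w)"]
          scalar_prod_add_distrib[OF u Gu tGw] scalar_prod_add_distrib[OF tw Gu tGw]
          u w Gu Gw tGw sym' G
        by (simp add: \<mu>_def power2_eq_square algebra_simps)
    qed
    ultimately have "\<mu> * (1 + 2 * t * (w \<bullet> u) + t\<^sup>2 * (w \<bullet> w))
        \<le> \<mu> + 2 * t * (w \<bullet> (G *\<^sub>v u)) + t\<^sup>2 * (w \<bullet> (G *\<^sub>v w))"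
      using min[OF x] unfolding \<mu>_def[symmetric] by metis
    moreover have "2 * t * (w \<bullet> w) = 2 * t * (w \<bullet> (G *\<^sub>v u)) - \<mu> * (2 * t * (w \<bullet> u))"
      by (subst ww) (simp add: algebra_simps)
    ultimately show ?thesis unfolding c_def by (simp add: algebra_simps)
  qed
  have "w \<bullet> w = 0"
  proof (rule ccontr)
    assume "w \<bullet> w \<noteq> 0"
    then have W: "w \<bullet> w > 0" using scalar_prod_self_nonneg[of w] by simp
    \<comment> \<open>The form at \<open>u + t w\<close> is \<open>2 t (w \<bullet> w) + t\<^sup>2 c\<close>; at \<open>t = - (w \<bullet> w) / k\<close> with \<open>k > c\<close> the linear
      term dominates and the value is negative.\<close>
    define k where "k = \<bar>c\<bar> + 1"
    have k: "k > 0" "c < k" by (auto simp: k_def)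
    have "0 \<le> 2 * (- (w \<bullet> w) / k) * (w \<bullet> w) + (- (w \<bullet> w) / k)\<^sup>2 * c" by (rule var)
    also have "\<dots> = (w \<bullet> w)\<^sup>2 / k\<^sup>2 * (c - 2 * k)"
      using k by (simp add: field_simps power2_eq_square)
    also have "\<dots> < 0" using W k by (intro mult_pos_neg) auto
    finally show False by simp
  qed
  then have w0: "w = 0\<^sub>v p" using w by (rule scalar_prod_self_eq_0)
  have "G *\<^sub>v u = \<mu> \<cdot>\<^sub>v u"
  proof (rule eq_vecI)
    fix i assume "i < dim_vec (\<mu> \<cdot>\<^sub>v u)"
    then have i: "i < p" using u by simp
    then have "w $ i = 0" using w0 by simp
    then show "(G *\<^sub>v u) $ i = (\<mu> \<cdot>\<^sub>v u) $ i"
      using i u Gu unfolding w_def by auto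
  qed (use G u in auto)
  then show ?thesis by (simp only: \<mu>_def)
qed

text \<open>
  The minimal Rayleigh quotient is an eigenvalue. Hence the spectrum, a set of real eigenvalues, is
  nonempty, its \<^const>\<open>Min\<close> is attained, and that minimum is at most every Rayleigh quotient.
\<close>

lemma lambda_min_symmetric:
  fixes G :: "real mat"
  assumes G: "G \<in> carrier_mat p p" and p: "0 < p" and sym: "transpose_mat G = G"
  shows "eigenvalue G (lambda_min G)"
    and "x \<in> carrier_vec p \<Longrightarrow> lambda_min G * (x \<bullet> x) \<le> x \<bullet> (G *\<^sub>v x)"
proof -
  obtain u where u: "u \<in> carrier_vec p" "u \<bullet> u = 1"
    and min: "\<And>x. x \<in> carrier_vec p \<Longrightarrow> (u \<bullet> (G *\<^sub>v u)) * (x \<bullet> x) \<le> x \<bullet> (G *\<^sub>v x)"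
    using quadratic_form_attains_min_on_sphere[OF G p] by blast
  have "u \<noteq> 0\<^sub>v p" using u by auto
  then have "eigenvector G u (u \<bullet> (G *\<^sub>v u))"
    using rayleigh_minimizer_is_eigenvector[OF G sym u min] u G
    unfolding eigenvector_def by auto
  then have mem: "u \<bullet> (G *\<^sub>v u) \<in> spectrum G"
    by (auto simp: spectrum_def eigenvalue_def)
  have fin: "finite (spectrum G)" by (rule card_finite_spectrum(1)[OF G])
  have "lambda_min G \<in> spectrum G"
    unfolding lambda_min_def using fin mem by (intro Min_in) auto
  then show "eigenvalue G (lambda_min G)" by (simp add: spectrum_def)
  have "lambda_min G \<le> u \<bullet> (G *\<^sub>v u)"
    unfolding lambda_min_def using fin mem by (intro Min_le) auto
  then show "lambda_min G * (x \<bullet> x) \<le> x \<bullet> (G *\<^sub>v x)" if "x \<in> carrier_vec p"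
    using min[OF that] mult_right_mono[OF _ scalar_prod_self_nonneg[of x]] by fastforce
qed

section \<open>Conditioning of the design matrix\<close>

lemma scalar_prod_gram:
  fixes A :: "real mat"
  assumes A: "A \<in> carrier_mat N p" and x: "x \<in> carrier_vec p" and y: "y \<in> carrier_vec p"
  shows "y \<bullet> ((transpose_mat A * A) *\<^sub>v x) = (A *\<^sub>v y) \<bullet> (A *\<^sub>v x)"
proof -
  have At: "transpose_mat A \<in> carrier_mat p N" using A by simp
  have "(transpose_mat A * A) *\<^sub>v x = transpose_mat A *\<^sub>v (A *\<^sub>v x)"
    using assoc_mult_mat_vec[OF At A x] .
  moreover have "(A *\<^sub>v y) \<bullet> (A *\<^sub>v x) = y \<bullet> (transpose_mat A *\<^sub>v (A *\<^sub>v x))"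
    using transpose_vec_mult_scalar[OF At _ y, of "A *\<^sub>v x"] A x by simp
  ultimately show ?thesis by simp
qed

lemma sigma_min_le:
  fixes A :: "real mat"
  assumes A: "A \<in> carrier_mat N p" and p: "0 < p" and N: "0 < N" and x: "x \<in> carrier_vec p"
  shows "real N * sigma_min A * (x \<bullet> x) \<le> (A *\<^sub>v x) \<bullet> (A *\<^sub>v x)"
proof -
  let ?G = "(1 / real N) \<cdot>\<^sub>m (transpose_mat A * A)"
  have H: "transpose_mat A * A \<in> carrier_mat p p" using A by simp
  then have G: "?G \<in> carrier_mat p p" by simp
  have sym: "transpose_mat ?G = ?G"
    using A by (intro eq_matI) (auto simp: comm_scalar_prod[of _ N])
  have dim: "dim_row A = N" using A by simp
  have Gx: "?G *\<^sub>v x = (1 / real N) \<cdot>\<^sub>v ((transpose_mat A * A) *\<^sub>v x)"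
    using H x by (intro eq_vecI) auto
  have "sigma_min A * (x \<bullet> x) \<le> x \<bullet> (?G *\<^sub>v x)"
    unfolding sigma_min_def dim by (rule lambda_min_symmetric(2)[OF G p sym x])
  also have "\<dots> = ((A *\<^sub>v x) \<bullet> (A *\<^sub>v x)) / real N"
    unfolding Gx using scalar_prod_gram[OF A x x] H x by simp
  finally show ?thesis using N by (simp add: field_simps)
qed

text \<open>
  At an eigenvector \<open>x\<close> for \<open>\<sigma>\<close> the form \<open>\<sigma> (x \<bullet> x)\<close> equals \<open>|A x|\<^sup>2 / N\<close>, and \<open>A x\<close> is not zero because
  \<open>A\<^sup>T A\<close> has a left inverse.
\<close>

lemma sigma_min_pos:
  fixes A :: "real mat"
  assumes A: "A \<in> carrier_mat N p" and p: "0 < p" and N: "0 < N"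
    and H: "H \<in> carrier_mat p p" "H * (transpose_mat A * A) = 1\<^sub>m p"
  shows "0 < sigma_min A"
proof -
  let ?S = "transpose_mat A * A"
  let ?G = "(1 / real N) \<cdot>\<^sub>m ?S"
  have S: "?S \<in> carrier_mat p p" using A by simp
  then have G: "?G \<in> carrier_mat p p" by simp
  have sym: "transpose_mat ?G = ?G"
    using A by (intro eq_matI) (auto simp: comm_scalar_prod[of _ N])
  have dim: "dim_row A = N" using A by simp
  obtain x where x: "x \<in> carrier_vec p" "x \<noteq> 0\<^sub>v p" and ev: "?G *\<^sub>v x = sigma_min A \<cdot>\<^sub>v x"
    using lambda_min_symmetric(1)[OF G p sym] G
    unfolding sigma_min_def dim eigenvalue_def eigenvector_def by auto
  have Gx: "?G *\<^sub>v x = (1 / real N) \<cdot>\<^sub>v (?S *\<^sub>v x)"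
    using S x by (intro eq_vecI) auto
  have "sigma_min A * (x \<bullet> x) = x \<bullet> (?G *\<^sub>v x)" using x by (simp add: ev)
  also have "\<dots> = ((A *\<^sub>v x) \<bullet> (A *\<^sub>v x)) / real N"
    unfolding Gx using scalar_prod_gram[OF A x(1) x(1)] S x by simp
  finally have eq: "sigma_min A * (x \<bullet> x) = ((A *\<^sub>v x) \<bullet> (A *\<^sub>v x)) / real N" .
  have "A *\<^sub>v x \<noteq> 0\<^sub>v N"
  proof
    assume "A *\<^sub>v x = 0\<^sub>v N"
    moreover have "B *\<^sub>v 0\<^sub>v n = 0\<^sub>v m" if "B \<in> carrier_mat m n" for B :: "real mat" and m n
      using that by (intro eq_vecI) auto
    ultimately have "H *\<^sub>v (?S *\<^sub>v x) = 0\<^sub>v p"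
      using A H(1) x by simp
    then show False using assoc_mult_mat_vec[OF H(1) S x(1)] H(2) x by simp
  qed
  then have "(A *\<^sub>v x) \<bullet> (A *\<^sub>v x) \<noteq> 0"
    using scalar_prod_self_eq_0[of "A *\<^sub>v x" N] A x by auto
  then have "sigma_min A * (x \<bullet> x) > 0"
    unfolding eq using scalar_prod_self_nonneg[of "A *\<^sub>v x"] N by simp
  then show ?thesis using scalar_prod_self_nonneg[of x] by (simp add: zero_less_mult_iff)
qed

text \<open>
  The Rayleigh quotient at a unit coordinate vector is the mean square of a column of \<open>A\<close>.
\<close>

lemma sigma_min_le_max_abs_entry:
  fixes A :: "real mat"
  assumes A: "A \<in> carrier_mat N p" and p: "0 < p" and N: "0 < N"
  shows "sigma_min A \<le> (max_abs_entry A)\<^sup>2"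
proof -
  let ?e = "unit_vec p 0 :: real vec"
  have entry: "\<bar>A $$ (i,0)\<bar> \<le> max_abs_entry A" if "i < N" for i
    unfolding max_abs_entry_def
    using elements_matI[OF A that p] by (intro Max_ge) (auto simp: elements_mat_def)
  have Ae: "(A *\<^sub>v ?e) $ i = A $$ (i,0)" if "i < N" for i
    using that A p by simp
  have "real N * sigma_min A = real N * sigma_min A * (?e \<bullet> ?e)" using p by simp
  also have "\<dots> \<le> (A *\<^sub>v ?e) \<bullet> (A *\<^sub>v ?e)" by (rule sigma_min_le[OF A p N]) simp
  also have "\<dots> = (\<Sum>i<N. (A $$ (i,0))\<^sup>2)"
    unfolding scalar_prod_def power2_eq_square
    using A Ae by (intro sum.cong) (auto simp del: index_mult_mat_vec)
  also have "\<dots> \<le> (\<Sum>i<N. (max_abs_entry A)\<^sup>2)"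
    using entry by (intro sum_mono) (simp add: abs_le_square_iff[symmetric] order_trans[OF _ abs_ge_self])
  finally show ?thesis using N by simp
qed

text \<open>
  The quantity \<open>c = |A y|\<^sup>2\<close> is \<open>y \<bullet> e\<^sub>i = y\<^sub>i\<close>, so it is at once a value of the quadratic form and a
  coordinate of its argument. Therefore \<open>N \<sigma> c\<^sup>2 \<le> N \<sigma> (y \<bullet> y) \<le> c\<close>, and \<open>c\<close> cancels.
\<close>

lemma gram_inverse_column_bound:
  fixes A :: "real mat"
  assumes A: "A \<in> carrier_mat N p" and N: "0 < N" and pos: "0 < sigma_min A"
    and i: "i < p" and y: "y \<in> carrier_vec p"
    and Sy: "(transpose_mat A * A) *\<^sub>v y = unit_vec p i"
  shows "(A *\<^sub>v y) \<bullet> (A *\<^sub>v y) \<le> 1 / (real N * sigma_min A)"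
proof -
  define c where "c = (A *\<^sub>v y) \<bullet> (A *\<^sub>v y)"
  have c: "c = y $ i"
    unfolding c_def scalar_prod_gram[OF A y y, symmetric] Sy using y i by simp
  have "real N * sigma_min A * c\<^sup>2 \<le> real N * sigma_min A * (y \<bullet> y)"
    unfolding c using square_entry_le_scalar_prod_self[of i y] y i pos
    by (intro mult_left_mono) auto
  also have "\<dots> \<le> c"
    unfolding c_def using sigma_min_le[OF A _ N y] i by simp
  finally have le: "real N * sigma_min A * c\<^sup>2 \<le> c" .
  have "c \<le> 1 / (real N * sigma_min A)"
  proof (cases "c = 0")
    case False
    then have "c > 0" using scalar_prod_self_nonneg[of "A *\<^sub>v y"] by (simp add: c_def)
    then show ?thesis using le N pos by (simp add: field_simps power2_eq_square)
  qed (use N pos in auto)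
  then show ?thesis by (simp add: c_def)
qed

section \<open>The estimation error as a linear combination of the noise\<close>

lemma mat_inverse_invertible:
  fixes S :: "'a :: field mat"
  assumes S: "S \<in> carrier_mat p p" and inv: "invertible_mat S"
  obtains H where "mat_inverse S = Some H" "H \<in> carrier_mat p p" "S * H = 1\<^sub>m p" "H * S = 1\<^sub>m p"
proof (cases "mat_inverse S")
  case None
  obtain B where B: "S * B = 1\<^sub>m p" "B * S = 1\<^sub>m (dim_row B)"
    using inv S unfolding invertible_mat_def inverts_mat_def by auto
  have "dim_col B = dim_col (S * B)" by simp
  then have "dim_col B = p" using B(1) by simp
  moreover have "dim_row B = dim_col (B * S)" using B(2) by simp
  ultimately have "B \<in> carrier_mat p p" using S by auto
  then have "S \<in> Units (ring_mat TYPE('a) p ())"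
    using S B by (auto simp: Units_def ring_mat_simps)
  then show ?thesis using mat_inverse(1)[OF S None, of "()"] by blast
qed (use mat_inverse(2)[OF S] that in blast)

text \<open>
  The error \<open>d\<close> satisfies \<open>S d = A\<^sup>T w\<close> for \<open>S = A\<^sup>T A\<close>; testing this equation with \<open>y\<close> and moving \<open>S\<close>
  to the other side gives \<open>e\<^sub>i \<bullet> d = (S y) \<bullet> d = y \<bullet> A\<^sup>T w\<close>.
\<close>

lemma least_squares_error_component:
  fixes A :: "real mat"
  assumes A: "A \<in> carrier_mat N p" and \<theta>: "\<theta> \<in> carrier_vec p" and w: "w \<in> carrier_vec N"
    and S: "mat_inverse (transpose_mat A * A) = Some H" "H \<in> carrier_mat p p"
      "(transpose_mat A * A) * H = 1\<^sub>m p"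
    and i: "i < p" and y: "y \<in> carrier_vec p"
    and Sy: "(transpose_mat A * A) *\<^sub>v y = unit_vec p i"
  shows "(least_squares A (A *\<^sub>v \<theta> + w) - \<theta>) $ i = (A *\<^sub>v y) \<bullet> w"
proof -
  let ?S = "transpose_mat A * A"
  have At: "transpose_mat A \<in> carrier_mat p N" and cS: "?S \<in> carrier_mat p p"
    using A by auto
  have sym: "transpose_mat ?S = ?S"
    using A by (intro eq_matI) (auto simp: comm_scalar_prod[of _ N])
  have A\<theta>: "A *\<^sub>v \<theta> \<in> carrier_vec N" and Atw: "transpose_mat A *\<^sub>v w \<in> carrier_vec p"
    and S\<theta>: "?S *\<^sub>v \<theta> \<in> carrier_vec p"
    using A \<theta> w cS At by auto
  define z where "z = least_squares A (A *\<^sub>v \<theta> + w)"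
  define b where "b = transpose_mat A *\<^sub>v (A *\<^sub>v \<theta> + w)"
  have b: "b \<in> carrier_vec p" unfolding b_def using At A\<theta> w by simp
  have b': "b = ?S *\<^sub>v \<theta> + transpose_mat A *\<^sub>v w"
    unfolding b_def using mult_add_distrib_mat_vec[OF At A\<theta> w] assoc_mult_mat_vec[OF At A \<theta>] by simp
  have z: "z = H *\<^sub>v b" unfolding z_def least_squares_def S(1) b_def by simp
  have cz: "z \<in> carrier_vec p" unfolding z using S(2) b by simp
  have "?S *\<^sub>v z = b" unfolding z using assoc_mult_mat_vec[OF cS S(2) b] S(3) b by simp
  then have Sd: "?S *\<^sub>v (z - \<theta>) = transpose_mat A *\<^sub>v w"
    using mult_minus_distrib_mat_vec[OF cS cz \<theta>] b' S\<theta> Atw by auto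
  have d: "z - \<theta> \<in> carrier_vec p" using cz \<theta> by simp
  have "(z - \<theta>) $ i = unit_vec p i \<bullet> (z - \<theta>)" using d i by simp
  also have "\<dots> = (?S *\<^sub>v y) \<bullet> (z - \<theta>)" by (simp only: Sy)
  also have "\<dots> = y \<bullet> (?S *\<^sub>v (z - \<theta>))"
    using transpose_vec_mult_scalar[OF cS d y] unfolding sym .
  also have "\<dots> = y \<bullet> (transpose_mat A *\<^sub>v w)" unfolding Sd ..
  also have "\<dots> = (A *\<^sub>v y) \<bullet> w"
    using transpose_vec_mult_scalar[OF At w y] by simp
  finally show ?thesis by (simp only: z_def)
qed

section \<open>Sub-Gaussian martingale sums\<close>

text \<open>
  Induction on the number of terms: the exponential of the first \<open>N\<close> terms is \<open>F N\<close>-measurable, so the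
  exponential of term \<open>N + 1\<close> may be replaced by its conditional expectation given \<open>F N\<close>, which is at
  most a constant. Integrals in \<^typ>\<open>ennreal\<close> make integrability questions disappear.
\<close>

lemma sub_Gaussian_martingale_mgf:
  fixes v :: "nat \<Rightarrow> 'a \<Rightarrow> real" and c :: "nat \<Rightarrow> real"
  assumes P: "prob_space M"
    and mds: "martingale_difference_sequence M F v"
    and sG: "conditionally_sub_Gaussian M F R v"
  shows "(\<integral>\<^sup>+\<omega>. ennreal (exp (s * (\<Sum>i<N. c i * v (Suc i) \<omega>))) \<partial>M)
           \<le> ennreal (exp (s\<^sup>2 * R\<^sup>2 / 2 * (\<Sum>i<N. (c i)\<^sup>2)))"
proof (induction N)
  case 0
  interpret prob_space M by (rule P)
  show ?case by (simp add: emeasure_space_1)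
next
  case (Suc N)
  interpret prob_space M by (rule P)
  have filt: "filtration (space M) F" and sub: "\<And>n. subalgebra M (F n)"
    and adapted: "\<And>n. 1 \<le> n \<Longrightarrow> v n \<in> borel_measurable (F n)"
    using mds unfolding martingale_difference_sequence_def by auto
  interpret finite_measure_subalgebra M "F N"
    by unfold_locales (rule sub)
  define X where "X \<omega> = ennreal (exp (s * (\<Sum>i<N. c i * v (Suc i) \<omega>)))" for \<omega>
  define Y where "Y \<omega> = ennreal (exp ((s * c N) * v (Suc N) \<omega>))" for \<omega>
  have past: "v (Suc i) \<in> borel_measurable (F N)" if "i < N" for i
  proof -
    have "subalgebra (F N) (F (Suc i))"
      using filtration.sets_F_mono[OF filt, of "Suc i" N] filtration.space_F[OF filt] that
      by (auto simp: subalgebra_def)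
    then show ?thesis using adapted[of "Suc i"] by (auto intro: measurable_from_subalg)
  qed
  have X [measurable]: "X \<in> borel_measurable (F N)"
    unfolding X_def using past by measurable
  have v_meas: "v (Suc N) \<in> borel_measurable M"
    using adapted[of "Suc N"] sub by (auto intro: measurable_from_subalg)
  then have Y: "Y \<in> borel_measurable M"
    unfolding Y_def by measurable
  have bound: "AE \<omega> in M. nn_cond_exp M (F N) Y \<omega> \<le> ennreal (exp ((s * c N)\<^sup>2 * R\<^sup>2 / 2))"
    using sG unfolding conditionally_sub_Gaussian_def Y_def by (auto dest!: spec[of _ "Suc N"])
  have "(\<integral>\<^sup>+\<omega>. ennreal (exp (s * (\<Sum>i<Suc N. c i * v (Suc i) \<omega>))) \<partial>M) = (\<integral>\<^sup>+\<omega>. X \<omega> * Y \<omega> \<partial>M)"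
    unfolding X_def Y_def
    by (intro nn_integral_cong) (simp add: ennreal_mult'[symmetric] exp_add[symmetric] algebra_simps)
  also have "\<dots> = (\<integral>\<^sup>+\<omega>. X \<omega> * nn_cond_exp M (F N) Y \<omega> \<partial>M)"
    by (rule nn_cond_exp_intg[OF X Y, symmetric])
  also have "\<dots> \<le> (\<integral>\<^sup>+\<omega>. X \<omega> * ennreal (exp ((s * c N)\<^sup>2 * R\<^sup>2 / 2)) \<partial>M)"
    using bound by (intro nn_integral_mono_AE) (auto elim!: eventually_mono intro!: mult_left_mono)
  also have "\<dots> = (\<integral>\<^sup>+\<omega>. X \<omega> \<partial>M) * ennreal (exp ((s * c N)\<^sup>2 * R\<^sup>2 / 2))"
    by (rule nn_integral_multc) (rule measurable_from_subalg[OF sub X])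
  also have "\<dots> \<le> ennreal (exp (s\<^sup>2 * R\<^sup>2 / 2 * (\<Sum>i<N. (c i)\<^sup>2))) * ennreal (exp ((s * c N)\<^sup>2 * R\<^sup>2 / 2))"
    using Suc.IH unfolding X_def by (rule mult_right_mono) simp
  also have "\<dots> = ennreal (exp (s\<^sup>2 * R\<^sup>2 / 2 * (\<Sum>i<Suc N. (c i)\<^sup>2)))"
    by (simp add: ennreal_mult'[symmetric] exp_add[symmetric] power_mult_distrib algebra_simps add_divide_distrib)
  finally show ?case .
qed

text \<open>
  The parameter \<open>s\<close> is left free, and not set to the minimizer \<open>r / (R\<^sup>2 C)\<close> of the exponent, so that
  the bound also covers \<open>R = 0\<close>.
\<close>

lemma sub_Gaussian_martingale_upper_tail:
  fixes v :: "nat \<Rightarrow> 'a \<Rightarrow> real" and c :: "nat \<Rightarrow> real"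
  assumes P: "prob_space M"
    and mds: "martingale_difference_sequence M F v"
    and sG: "conditionally_sub_Gaussian M F R v"
    and s: "0 < s" and C: "(\<Sum>i<N. (c i)\<^sup>2) \<le> C"
  shows "measure M {\<omega> \<in> space M. r \<le> (\<Sum>i<N. c i * v (Suc i) \<omega>)} \<le> exp (s\<^sup>2 * R\<^sup>2 / 2 * C - s * r)"
proof -
  interpret prob_space M by (rule P)
  define X where "X \<omega> = (\<Sum>i<N. c i * v (Suc i) \<omega>)" for \<omega>
  have "v (Suc i) \<in> borel_measurable M" for i
    using mds unfolding martingale_difference_sequence_def
    by (auto intro: measurable_from_subalg)
  then have X: "X \<in> borel_measurable M" unfolding X_def by measurable
  have "emeasure M {\<omega> \<in> space M. r \<le> X \<omega>}
          \<le> ennreal (exp (- s * r)) * (\<integral>\<^sup>+\<omega>. ennreal (exp (s * X \<omega>)) * indicator (space M) \<omega> \<partial>M)"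
    using X by (intro Chernoff_ineq_nn_integral_ge[OF s]) auto
  also have "\<dots> = ennreal (exp (- s * r)) * (\<integral>\<^sup>+\<omega>. ennreal (exp (s * X \<omega>)) \<partial>M)"
    by (intro arg_cong2[where f = "(*)"] nn_integral_cong) auto
  also have "\<dots> \<le> ennreal (exp (- s * r)) * ennreal (exp (s\<^sup>2 * R\<^sup>2 / 2 * (\<Sum>i<N. (c i)\<^sup>2)))"
    unfolding X_def by (intro mult_left_mono sub_Gaussian_martingale_mgf[OF P mds sG]) simp
  also have "\<dots> = ennreal (exp (s\<^sup>2 * R\<^sup>2 / 2 * (\<Sum>i<N. (c i)\<^sup>2) - s * r))"
    by (simp add: ennreal_mult'[symmetric] exp_add[symmetric])
  also have "\<dots> \<le> ennreal (exp (s\<^sup>2 * R\<^sup>2 / 2 * C - s * r))"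
    using mult_left_mono[OF C, of "s\<^sup>2 * R\<^sup>2 / 2"] by (intro ennreal_leI) simp
  finally show ?thesis
    unfolding X_def by (simp add: emeasure_eq_measure)
qed

lemma sub_Gaussian_martingale_tail:
  fixes v :: "nat \<Rightarrow> 'a \<Rightarrow> real" and c :: "nat \<Rightarrow> real"
  assumes P: "prob_space M"
    and mds: "martingale_difference_sequence M F v"
    and sG: "conditionally_sub_Gaussian M F R v"
    and s: "0 < s" and C: "(\<Sum>i<N. (c i)\<^sup>2) \<le> C"
  shows "measure M {\<omega> \<in> space M. r \<le> \<bar>\<Sum>i<N. c i * v (Suc i) \<omega>\<bar>}
           \<le> 2 * exp (s\<^sup>2 * R\<^sup>2 / 2 * C - s * r)"
proof -
  interpret prob_space M by (rule P)
  define X where "X \<omega> = (\<Sum>i<N. c i * v (Suc i) \<omega>)" for \<omega>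
  have "v (Suc i) \<in> borel_measurable M" for i
    using mds unfolding martingale_difference_sequence_def
    by (auto intro: measurable_from_subalg)
  then have X [measurable]: "X \<in> borel_measurable M" unfolding X_def by measurable
  have "{\<omega> \<in> space M. r \<le> \<bar>X \<omega>\<bar>}
          = {\<omega> \<in> space M. r \<le> X \<omega>} \<union> {\<omega> \<in> space M. r \<le> - X \<omega>}"
    by auto
  moreover have "measure M \<dots>
      \<le> measure M {\<omega> \<in> space M. r \<le> X \<omega>} + measure M {\<omega> \<in> space M. r \<le> - X \<omega>}"
    by (intro measure_Un_le) measurable
  moreover have "measure M {\<omega> \<in> space M. r \<le> X \<omega>} \<le> exp (s\<^sup>2 * R\<^sup>2 / 2 * C - s * r)"
    unfolding X_def by (rule sub_Gaussian_martingale_upper_tail[OF P mds sG s C])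
  moreover have "measure M {\<omega> \<in> space M. r \<le> - X \<omega>} \<le> exp (s\<^sup>2 * R\<^sup>2 / 2 * C - s * r)"
    using sub_Gaussian_martingale_upper_tail[OF P mds sG s, where c = "\<lambda>i. - c i" and N = N and C = C and r = r] C
    by (simp add: X_def sum_negf)
  ultimately show ?thesis unfolding X_def by simp
qed

section \<open>The sample size bound\<close>

lemma linf_norm_gt_iff:
  assumes "w \<in> carrier_vec p" and "0 < p"
  shows "r < linf_norm w \<longleftrightarrow> (\<exists>i<p. r < \<bar>w $ i\<bar>)"
proof -
  have eq: "{\<bar>w $ i\<bar> | i. i < dim_vec w} = (\<lambda>i. \<bar>w $ i\<bar>) ` {..<p}"
    using assms by auto
  show ?thesis
    unfolding linf_norm_def eq using assms(2) by (subst Max_gr_iff) auto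
qed

theorem mainTheorem4:
  fixes M :: "'a measure"
    and F :: "nat \<Rightarrow> 'a measure"
    and v :: "nat \<Rightarrow> 'a \<Rightarrow> real"
    and x :: "'a \<Rightarrow> real vec"
    and A :: "real mat"
    and \<theta>\<^sub>0 :: "real vec"
    and N p :: nat
    and R r \<epsilon> :: real
  assumes "prob_space M"
    and "0 < p" and "p < N"
    and "A \<in> carrier_mat N p"
    and "\<theta>\<^sub>0 \<in> carrier_vec p"
    and "invertible_mat (transpose_mat A * A)"
    and "\<And>\<omega>. \<omega> \<in> space M \<Longrightarrow> x \<omega> = A *\<^sub>v \<theta>\<^sub>0 + noise_vec N v \<omega>"
    and "\<And>n. 1 \<le> n \<Longrightarrow> integral\<^sup>L M (v n) = 0"
    and "martingale_difference_sequence M F v"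
    and "conditionally_sub_Gaussian M F R v"
    and "0 < \<epsilon>" and "0 < r"
    and "real N > sample_threshold A R r \<epsilon>"
  shows "measure M {\<omega> \<in> space M. linf_norm (least_squares A (x \<omega>) - \<theta>\<^sub>0) > r} < \<epsilon>"
proof -
  note P = assms(1) and p = assms(2) and A = assms(4) and \<theta> = assms(5)
    and model = assms(7) and mds = assms(9) and sG = assms(10) and \<epsilon> = assms(11) and r = assms(12)
  interpret prob_space M by (rule P)
  let ?S = "transpose_mat A * A"
  let ?bad = "{\<omega> \<in> space M. linf_norm (least_squares A (x \<omega>) - \<theta>\<^sub>0) > r}"
  have N: "0 < N" using assms(3) by simp
  have S: "?S \<in> carrier_mat p p" using A by simp
  obtain H where H: "mat_inverse ?S = Some H" "H \<in> carrier_mat p p" "?S * H = 1\<^sub>m p" "H * ?S = 1\<^sub>m p"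
    using mat_inverse_invertible[OF S assms(6)] .
  define \<sigma> where "\<sigma> = sigma_min A"
  define \<alpha> where "\<alpha> = max_abs_entry A"
  have \<sigma>: "0 < \<sigma>" "\<sigma> \<le> \<alpha>\<^sup>2"
    using sigma_min_pos[OF A p N H(2,4)] sigma_min_le_max_abs_entry[OF A p N]
    by (simp_all add: \<sigma>_def \<alpha>_def)
  define L where "L = ln (2 * real p / \<epsilon>)"
  have thr: "8 * \<alpha>\<^sup>2 * R\<^sup>2 / (r\<^sup>2 * \<sigma>\<^sup>2) * L < real N"
    using assms(13) A unfolding sample_threshold_def \<sigma>_def \<alpha>_def L_def by simp
  show ?thesis
  proof (cases "1 < \<epsilon>")
    case True
    then show ?thesis using prob_le_1[of ?bad] by linarith
  next
    case False
    then have L: "0 < L"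
      unfolding L_def using \<epsilon> p by (simp add: field_simps)
    define y where "y i = H *\<^sub>v unit_vec p i" for i
    have y: "y i \<in> carrier_vec p" and Sy: "?S *\<^sub>v y i = unit_vec p i" for i
      using H(2) assoc_mult_mat_vec[OF S H(2), of "unit_vec p i"] H(3) unfolding y_def by auto
    define c where "c i k = (A *\<^sub>v y i) $ k" for i k
    define E where "E i \<omega> = (\<Sum>k<N. c i k * v (Suc k) \<omega>)" for i \<omega>
    have comp: "(least_squares A (x \<omega>) - \<theta>\<^sub>0) $ i = E i \<omega>" if "\<omega> \<in> space M" "i < p" for \<omega> i
    proof -
      have "noise_vec N v \<omega> \<in> carrier_vec N" by (simp add: noise_vec_def)
      from least_squares_error_component[OF A \<theta> this H(1-3) that(2) y Sy] show ?thesis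
        unfolding model[OF that(1)] E_def c_def
        by (simp add: scalar_prod_def noise_vec_def atLeast0LessThan)
    qed
    have csum: "(\<Sum>k<N. (c i k)\<^sup>2) \<le> 1 / (real N * \<sigma>)" if "i < p" for i
    proof -
      have "(\<Sum>k<N. (c i k)\<^sup>2) = (A *\<^sub>v y i) \<bullet> (A *\<^sub>v y i)"
        unfolding c_def scalar_prod_def power2_eq_square using A by (simp add: atLeast0LessThan)
      then show ?thesis
        using gram_inverse_column_bound[OF A N _ that y Sy] \<sigma> by (simp add: \<sigma>_def)
    qed
    \<comment> \<open>The optimal parameter \<open>r N \<sigma> / R\<^sup>2\<close> of the Chernoff bound degenerates for \<open>R = 0\<close>; this one
      does not involve \<open>R\<close> and still brings the bound below \<open>exp (- L) = \<epsilon> / (2 p)\<close>.\<close>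
    define s where "s = 2 * L / r"
    have s: "0 < s" using L r by (simp add: s_def)
    have exponent: "s\<^sup>2 * R\<^sup>2 / 2 * (1 / (real N * \<sigma>)) - s * r < - L"
    proof -
      have "8 * R\<^sup>2 * L / (r\<^sup>2 * \<sigma>) = 8 * \<sigma> * R\<^sup>2 / (r\<^sup>2 * \<sigma>\<^sup>2) * L"
        using \<sigma> r by (simp add: field_simps power2_eq_square)
      also have "\<dots> \<le> 8 * \<alpha>\<^sup>2 * R\<^sup>2 / (r\<^sup>2 * \<sigma>\<^sup>2) * L"
        using \<sigma> L by (intro mult_right_mono divide_right_mono) auto
      finally have "8 * R\<^sup>2 * L / (r\<^sup>2 * \<sigma>) < real N" using thr by simp
      then have n: "8 * R\<^sup>2 * L < real N * r\<^sup>2 * \<sigma>" using \<sigma> r by (simp add: field_simps)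
      have "2 * R\<^sup>2 * L < real N * r\<^sup>2 * \<sigma>"
        by (rule le_less_trans[OF _ n]) (use L in auto)
      then have "2 * R\<^sup>2 * L / (real N * r\<^sup>2 * \<sigma>) < 1"
        using \<sigma> r N by simp
      then have "L * (2 * R\<^sup>2 * L / (real N * r\<^sup>2 * \<sigma>)) < L * 1"
        using L by (rule mult_strict_left_mono)
      moreover have "s\<^sup>2 * R\<^sup>2 / 2 * (1 / (real N * \<sigma>)) = L * (2 * R\<^sup>2 * L / (real N * r\<^sup>2 * \<sigma>))"
        unfolding s_def using \<sigma> r N by (simp add: field_simps power2_eq_square)
      moreover have "s * r = 2 * L" using r by (simp add: s_def)
      ultimately show ?thesis by simp
    qed
    have tail: "measure M {\<omega> \<in> space M. r \<le> \<bar>E i \<omega>\<bar>} < \<epsilon> / p" if "i < p" for i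
    proof -
      have "measure M {\<omega> \<in> space M. r \<le> \<bar>E i \<omega>\<bar>}
              \<le> 2 * exp (s\<^sup>2 * R\<^sup>2 / 2 * (1 / (real N * \<sigma>)) - s * r)"
        unfolding E_def by (rule sub_Gaussian_martingale_tail[OF P mds sG s csum[OF that]])
      also have "\<dots> < 2 * exp (- L)" using exponent by simp
      also have "\<dots> = \<epsilon> / p" unfolding L_def using \<epsilon> p by (simp add: exp_minus field_simps)
      finally show ?thesis .
    qed
    have "v (Suc k) \<in> borel_measurable M" for k
      using mds unfolding martingale_difference_sequence_def
      by (auto intro: measurable_from_subalg)
    then have E [measurable]: "E i \<in> borel_measurable M" for i
      unfolding E_def by measurable
    have dim: "least_squares A (x \<omega>) - \<theta>\<^sub>0 \<in> carrier_vec p" for \<omega>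
      by (rule carrier_vecI) (use \<theta> in simp)
    have "?bad \<subseteq> (\<Union>i<p. {\<omega> \<in> space M. r \<le> \<bar>E i \<omega>\<bar>})"
      using comp by (auto simp: linf_norm_gt_iff[OF dim p])
    then have "measure M ?bad \<le> measure M (\<Union>i<p. {\<omega> \<in> space M. r \<le> \<bar>E i \<omega>\<bar>})"
      by (intro finite_measure_mono) measurable
    also have "\<dots> \<le> (\<Sum>i<p. measure M {\<omega> \<in> space M. r \<le> \<bar>E i \<omega>\<bar>})"
      by (intro measure_UNION_le) auto
    also have "\<dots> < (\<Sum>i<p. \<epsilon> / p)"
      using tail p by (intro sum_strict_mono) auto
    also have "\<dots> = \<epsilon>" using p by simp
    finally show ?thesis .
  qed
qed

end
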